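(* Let $0<\delta<1$ be such that $d(\delta)>0$, where $d(\delta)=\inf\{2^n|\delta-k2^{-n}| : n\ge 0,\ k\in\mathbb{Z}\}$. Then \[ \mathrm{BMO}(\mathbb{T})=\mathrm{BMO}_{\mathcal D}(\mathbb{T})\cap \mathrm{BMO}_{\mathcal D^\delta}(\mathbb{T}) \] with equivalent norms; that is, the two sides are equal as sets of functions in $L^1(\mathbb{T})$, and there are constants $c,C>0$ depending only on $\delta$ such that for all $\varphi\in \mathrm{BMO}(\mathbb{T})$, $c\,\|\varphi\|_{\mathrm{BMO}(\mathbb{T})}\le \max\{\|\varphi\|_{\mathrm{BMO}_{\mathcal D}(\mathbb{T})},\|\varphi\|_{\mathrm{BMO}_{\mathcal D^\delta}(\mathbb{T})}\}\le C\,\|\varphi\|_{\mathrm{BMO}(\mathbb{T})}$.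
   Context: $\mathbb{T}$ is the unit circle, identified with $(0,2\pi]$ (points taken modulo $2\pi$), with Lebesgue measure $d\theta$ of total mass $2\pi$; $|I|$ is the length of an interval (arc) $I\subset\mathbb{T}$ of positive length, and $\varphi_I=\frac1{|I|}\int_I\varphi\,d\theta$. $\mathrm{BMO}(\mathbb{T})$ is the set of $\varphi\in L^1(\mathbb{T})$ with $\|\varphi\|_{\mathrm{BMO}(\mathbb{T})}=\sup_I \frac1{|I|}\int_I|\varphi-\varphi_I|\,d\theta<\infty$, the supremum being over all intervals $I$ on $\mathbb{T}$. The dyadic intervals are $D_n^k=(2\pi k2^{-n},2\pi(k+1)2^{-n}]$, and the translated dyadic intervals are $D_n^{\delta,k}=(2\delta\pi+2\pi k2^{-n},2\delta\pi+2\pi(k+1)2^{-n}]$ (modulo $2\pi$), for $n\ge0$, $0\le k<2^n$. $\mathrm{BMO}_{\mathcal D}(\mathbb{T})$ is the set of $\varphi\in L^1(\mathbb{T})$ with $\|\varphi\|_{\mathrm{BMO}_{\mathcal D}(\mathbb{T})}=\sup_{n,k}\frac{2^n}{2\pi}\int_{D_n^k}|\varphi-\varphi_{D_n^k}|\,d\theta<\infty$, and $\mathrm{BMO}_{\mathcal D^\delta}(\mathbb{T})$, $\|\cdot\|_{\mathrm{BMO}_{\mathcal D^\delta}(\mathbb{T})}$ are defined in the same way with $D_n^{\delta,k}$ in place of $D_n^k$. (These are seminorms vanishing on constants.) *)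

theory Defs
  imports "HOL-Analysis.Analysis"
begin

definition circle :: "real set" where
  "circle = {0<..2 * pi}"

text \<open>The subset of the circle covered by \<open>A\<close>, with points taken modulo \<open>2\<pi>\<close>.\<close>

definition wrap :: "real set \<Rightarrow> real set" where
  "wrap A = {\<theta> \<in> circle. \<exists>m::int. \<theta> + 2 * pi * of_int m \<in> A}"

text \<open>All intervals on the circle of positive length, with any choice of endpoints included.
  An arc may pass through the point \<open>2\<pi>\<close>, and the whole circle is an arc.\<close>

definition circle_arcs :: "real set set" where
  "circle_arcs = {wrap J | J. is_interval J \<and> 0 < measure lebesgue (wrap J)}"

definition dyadic_interval :: "nat \<Rightarrow> nat \<Rightarrow> real set" where
  "dyadic_interval n k = {2 * pi * real k / 2 ^ n <.. 2 * pi * (real k + 1) / 2 ^ n}"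

definition shifted_dyadic_interval :: "real \<Rightarrow> nat \<Rightarrow> nat \<Rightarrow> real set" where
  "shifted_dyadic_interval \<delta> n k =
     wrap {2 * \<delta> * pi + 2 * pi * real k / 2 ^ n <.. 2 * \<delta> * pi + 2 * pi * (real k + 1) / 2 ^ n}"

definition dyadic_arcs :: "real set set" where
  "dyadic_arcs = {dyadic_interval n k | n k. k < 2 ^ n}"

definition shifted_dyadic_arcs :: "real \<Rightarrow> real set set" where
  "shifted_dyadic_arcs \<delta> = {shifted_dyadic_interval \<delta> n k | n k. k < 2 ^ n}"

text \<open>Elements of \<open>L\<^sup>1\<close> are represented by functions rather than by classes modulo null sets.
  Values outside \<open>circle\<close> are irrelevant.\<close>

definition L1_circle :: "(real \<Rightarrow> complex) set" where
  "L1_circle = {\<phi>. set_integrable lebesgue circle \<phi>}"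

definition average :: "(real \<Rightarrow> complex) \<Rightarrow> real set \<Rightarrow> complex" where
  "average \<phi> I = (LINT \<theta>:I|lebesgue. \<phi> \<theta>) /\<^sub>R measure lebesgue I"

definition mean_oscillation :: "(real \<Rightarrow> complex) \<Rightarrow> real set \<Rightarrow> real" where
  "mean_oscillation \<phi> I =
     (LINT \<theta>:I|lebesgue. norm (\<phi> \<theta> - average \<phi> I)) / measure lebesgue I"

text \<open>The three spaces differ only in the family of arcs over which the supremum is taken.
  Every member of \<open>dyadic_arcs\<close> or \<open>shifted_dyadic_arcs \<delta>\<close> has length \<open>2\<pi>/2^n\<close>, so
  \<open>mean_oscillation\<close> carries the usual normalisation \<open>2^n/2\<pi>\<close> for these two families.\<close>

definition bmo_norm :: "real set set \<Rightarrow> (real \<Rightarrow> complex) \<Rightarrow> ereal" where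
  "bmo_norm \<I> \<phi> = (SUP I\<in>\<I>. ereal (mean_oscillation \<phi> I))"

definition BMO :: "real set set \<Rightarrow> (real \<Rightarrow> complex) set" where
  "BMO \<I> = {\<phi> \<in> L1_circle. bmo_norm \<I> \<phi> < \<infinity>}"

definition dyadic_separation :: "real \<Rightarrow> real" where
  "dyadic_separation \<delta> =
     Inf {2 ^ n * \<bar>\<delta> - of_int k / 2 ^ n\<bar> | (n::nat) (k::int). True}"

end

theory Submission imports Defs begin

text \<open>
  Write \<open>d\<close> for \<open>dyadic_separation \<delta>\<close>. One inequality is immediate, with constant \<open>1\<close>, because
  dyadic arcs of either kind are arcs. The other one is the one-third trick: every arc \<open>I\<close> lies
  in an arc \<open>D\<close> of one of the two dyadic families with \<open>|D| \<le> (2/d) |I|\<close>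
  (lemma \<open>dyadic_cover\<close>).

  The reason is that at generation \<open>n\<close> the cells of the two families end at the points
  \<open>2\<pi>k/2^n\<close> and \<open>2\<pi>\<delta> + 2\<pi>k/2^n\<close> respectively, and \<open>d > 0\<close> says precisely that a point of the
  first grid and a point of the second are at distance at least \<open>2\<pi>d/2^n\<close>, in every generation.
  An arc shorter than this cannot meet both grids, so it fits inside a single cell of a family
  whose grid it misses. Choosing \<open>n\<close> with \<open>2\<pi>d/2^(n+1) \<le> |I| < 2\<pi>d/2^n\<close> makes that cell
  comparable to \<open>I\<close>; an arc of length at least \<open>2\<pi>d\<close> is comparable to the whole circle, which is
  the dyadic arc of generation \<open>0\<close>.

  Enlarging \<open>I\<close> to \<open>D\<close> costs the factor \<open>2|D|/|I|\<close> in the mean oscillation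
  (lemma \<open>mean_oscillation_subset\<close>), which is at most \<open>4/d\<close>. Hence \<open>c = d/4\<close> and \<open>C = 1\<close> work
  for every integrable function, and the equality of the spaces follows from the same two
  inequalities.

  Arcs are treated through the intervals of the line that they come from: a grid is invariant
  under translation by \<open>2\<pi>\<close>, so it can be avoided on the line, and only lengths have to be
  carried over to the circle.
\<close>

section \<open>Intervals on the circle\<close>

lemma wrap_mono: "A \<subseteq> B \<Longrightarrow> wrap A \<subseteq> wrap B"
  unfolding wrap_def by blast

lemma wrap_translate: "wrap ((\<lambda>x. x + 2 * pi * of_int m) ` A) = wrap A"
proof -
  have "(\<exists>j::int. \<theta> + 2 * pi * of_int j \<in> (\<lambda>x. x + 2 * pi * of_int m) ` A)
      \<longleftrightarrow> (\<exists>j::int. \<theta> + 2 * pi * of_int j \<in> A)" for \<theta>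
  proof
    assume "\<exists>j::int. \<theta> + 2 * pi * of_int j \<in> (\<lambda>x. x + 2 * pi * of_int m) ` A"
    then obtain j :: int and x where "x \<in> A" "\<theta> + 2 * pi * of_int j = x + 2 * pi * of_int m"
      by blast
    then have "\<theta> + 2 * pi * of_int (j - m) \<in> A"
      by (simp add: algebra_simps)
    then show "\<exists>j::int. \<theta> + 2 * pi * of_int j \<in> A" by blast
  next
    assume "\<exists>j::int. \<theta> + 2 * pi * of_int j \<in> A"
    then obtain j :: int where j: "\<theta> + 2 * pi * of_int j \<in> A" by blast
    have "\<theta> + 2 * pi * of_int (j + m) \<in> (\<lambda>x. x + 2 * pi * of_int m) ` A"
      by (rule image_eqI[OF _ j]) (simp add: algebra_simps)
    then show "\<exists>j::int. \<theta> + 2 * pi * of_int j \<in> (\<lambda>x. x + 2 * pi * of_int m) ` A" by blast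
  qed
  then show ?thesis unfolding wrap_def by simp
qed

lemma wrap_translate_Ioc:
  "wrap {a + 2 * pi * of_int m <.. b + 2 * pi * of_int m} = wrap {a<..b}"
proof -
  have "{a + 2 * pi * of_int m <.. b + 2 * pi * of_int m} = (\<lambda>x. x + 2 * pi * of_int m) ` {a<..b}"
    by (auto intro: image_eqI[of x _ "x - 2 * pi * of_int m" for x])
  then show ?thesis by (simp only: wrap_translate)
qed

lemma int_eq_0_if_small_multiple:
  assumes "\<bar>2 * pi * of_int m\<bar> < 2 * pi"
  shows "m = (0::int)"
proof -
  have "2 * pi * \<bar>of_int m :: real\<bar> < 2 * pi * 1" using assms by (simp add: abs_mult)
  then have "\<bar>of_int m :: real\<bar> < 1" using mult_less_cancel_left_pos[of "2 * pi"] by auto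
  then show ?thesis by linarith
qed

lemma wrap_eq_self:
  assumes "A \<subseteq> circle"
  shows "wrap A = A"
proof
  show "wrap A \<subseteq> A"
  proof
    fix \<theta> assume "\<theta> \<in> wrap A"
    then obtain m :: int where m: "\<theta> \<in> circle" "\<theta> + 2 * pi * of_int m \<in> A"
      unfolding wrap_def by blast
    then have "\<theta> + 2 * pi * of_int m \<in> circle" using assms by blast
    then have "\<bar>2 * pi * of_int m\<bar> < 2 * pi" using m(1) unfolding circle_def by auto
    then have "m = 0" by (rule int_eq_0_if_small_multiple)
    then show "\<theta> \<in> A" using m by simp
  qed
  show "A \<subseteq> wrap A"
  proof
    fix \<theta> assume "\<theta> \<in> A"
    then have "\<theta> \<in> circle" "\<theta> + 2 * pi * of_int 0 \<in> A" using assms by auto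
    then show "\<theta> \<in> wrap A" unfolding wrap_def by blast
  qed
qed

lemma wrap_subset_circle: "wrap A \<subseteq> circle"
  unfolding wrap_def by blast

lemma wrap_Un: "wrap (A \<union> B) = wrap A \<union> wrap B"
  unfolding wrap_def by blast

lemma wrap_measurable:
  assumes "A \<in> sets borel"
  shows "wrap A \<in> sets lebesgue"
proof -
  have "wrap A = (\<Union>m::int. (\<lambda>\<theta>. \<theta> + 2 * pi * of_int m) -` A \<inter> circle)"
    unfolding wrap_def by blast
  moreover have "(\<lambda>\<theta>::real. \<theta> + 2 * pi * of_int m) -` A \<in> sets borel" for m :: int
    using measurable_sets[OF _ assms, of "\<lambda>\<theta>::real. \<theta> + 2 * pi * of_int m" borel] by simp
  ultimately have "wrap A \<in> sets borel"
    unfolding circle_def by (auto intro!: sets.countable_UN)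
  then show ?thesis by (simp add: sets_completionI_sets)
qed

text \<open>The only length computation on the circle: an interval no longer than one turn is wrapped
  without overlap. Lower bounds for other arcs come from intervals of this form inside them.\<close>

lemma measure_wrap_Ioc:
  assumes "0 \<le> L" "L \<le> 2 * pi"
  shows "measure lebesgue (wrap {a<..a + L}) = L"
proof -
  define m where "m = \<lfloor>a / (2 * pi)\<rfloor>"
  \<comment> \<open>The translate of \<open>a\<close> in \<open>[0, 2\<pi>)\<close>; the interval then reaches past \<open>2\<pi>\<close> at most once.\<close>
  define b where "b = a - 2 * pi * of_int m"
  have "of_int m \<le> a / (2 * pi)" "a / (2 * pi) < of_int m + 1"
    unfolding m_def by linarith+
  then have b: "0 \<le> b" "b < 2 * pi"
    unfolding b_def by (auto simp: field_simps)
  have eq: "wrap {a<..a + L} = wrap {b<..b + L}"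
    using wrap_translate_Ioc[of b m "b + L"] unfolding b_def by (simp add: algebra_simps)
  show ?thesis
  proof (cases "b + L \<le> 2 * pi")
    case True
    then have "wrap {b<..b + L} = {b<..b + L}"
      using b by (intro wrap_eq_self) (auto simp: circle_def)
    then show ?thesis using eq assms by simp
  next
    case False
    \<comment> \<open>The arc passes through the point \<open>2\<pi>\<close>, and is cut there.\<close>
    have "{b<..b + L} = {b<..2 * pi} \<union> {0 + 2 * pi * of_int 1<..(b + L - 2 * pi) + 2 * pi * of_int 1}"
      using False b by auto
    then have "wrap {b<..b + L} = wrap {b<..2 * pi} \<union> wrap {0<..b + L - 2 * pi}"
      by (simp only: wrap_Un wrap_translate_Ioc)
    also have "wrap {b<..2 * pi} = {b<..2 * pi}"
      using b by (intro wrap_eq_self) (auto simp: circle_def)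
    also have "wrap {0<..b + L - 2 * pi} = {0<..b + L - 2 * pi}"
      using b assms by (intro wrap_eq_self) (auto simp: circle_def)
    finally have "measure lebesgue (wrap {b<..b + L})
        = measure lebesgue ({b<..2 * pi} \<union> {0<..b + L - 2 * pi})" by simp
    also have "\<dots> = measure lebesgue {b<..2 * pi} + measure lebesgue {0<..b + L - 2 * pi}"
      using assms b False by (intro measure_Union) auto
    also have "\<dots> = L" using b False by simp
    finally show ?thesis using eq by simp
  qed
qed

lemma circle_fmeasurable: "circle \<in> fmeasurable lebesgue"
  unfolding circle_def by (rule fmeasurableI2[of "{0..2 * pi}"]) auto

lemma fmeasurable_arc:
  assumes "is_interval J"
  shows "wrap J \<in> fmeasurable lebesgue"
  using fmeasurableI2[OF circle_fmeasurable wrap_subset_circle]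
    wrap_measurable[OF real_interval_borel_measurable[OF assms]] .

text \<open>This makes it enough to study the shifted families, with \<open>\<delta>\<close> unrestricted.\<close>

lemma dyadic_arcs_eq_shifted: "dyadic_arcs = shifted_dyadic_arcs 0"
proof -
  have "dyadic_interval n k = shifted_dyadic_interval 0 n k" if "k < 2 ^ n" for n k
  proof -
    have "real k + 1 \<le> 2 ^ n" using that by (metis Suc_leI of_nat_Suc of_nat_le_iff of_nat_numeral of_nat_power add.commute)
    then have "(real k + 1) / 2 ^ n \<le> 1" by simp
    then have "2 * pi * ((real k + 1) / 2 ^ n) \<le> 2 * pi" by (intro mult_left_le) auto
    then have "2 * pi * (real k + 1) / 2 ^ n \<le> 2 * pi" by simp
    moreover have "0 \<le> 2 * pi * real k / 2 ^ n" by simp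
    ultimately have "dyadic_interval n k \<subseteq> circle"
      unfolding dyadic_interval_def circle_def
      by (meson greaterThanAtMost_iff order.strict_trans1 order.trans subsetI)
    then show ?thesis
      using wrap_eq_self unfolding shifted_dyadic_interval_def dyadic_interval_def by simp
  qed
  then show ?thesis unfolding dyadic_arcs_def shifted_dyadic_arcs_def by force
qed

lemma shifted_dyadic_interval_measure:
  "measure lebesgue (shifted_dyadic_interval \<delta> n k) = 2 * pi / 2 ^ n"
proof -
  have e: "2 * \<delta> * pi + 2 * pi * (real k + 1) / 2 ^ n
      = (2 * \<delta> * pi + 2 * pi * real k / 2 ^ n) + 2 * pi / 2 ^ n"
    by (simp add: field_simps)
  have "2 * pi / 2 ^ n \<le> 2 * pi" by (simp add: field_simps)
  then show ?thesis unfolding shifted_dyadic_interval_def e by (intro measure_wrap_Ioc) auto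
qed

lemma shifted_dyadic_arcs_subset: "shifted_dyadic_arcs \<delta> \<subseteq> circle_arcs"
proof -
  have "shifted_dyadic_interval \<delta> n k \<in> circle_arcs" for n k
    using shifted_dyadic_interval_measure[of \<delta> n k]
    unfolding circle_arcs_def shifted_dyadic_interval_def
    by (auto intro!: exI simp: is_interval_oc)
  then show ?thesis unfolding shifted_dyadic_arcs_def by auto
qed

text \<open>Cells are numbered by \<open>k < 2^n\<close> on the circle but by all integers on the line; division with
  remainder by \<open>2^n\<close> moves a cell by whole turns to one of the former.\<close>

lemma integer_cell_is_shifted_dyadic_arc:
  "wrap {2 * \<delta> * pi + 2 * pi * of_int k / 2 ^ n <.. 2 * \<delta> * pi + 2 * pi * (of_int k + 1) / 2 ^ n}
     \<in> shifted_dyadic_arcs \<delta>"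
proof -
  define r where "r = nat (k mod 2 ^ n)"
  define q where "q = k div 2 ^ n"
  have r: "r < 2 ^ n" and rk: "int r = k mod 2 ^ n"
    unfolding r_def by (auto simp: nat_less_iff)
  have "k = q * 2 ^ n + int r" unfolding q_def rk by (rule div_mult_mod_eq[symmetric])
  then have "(of_int k :: real) = of_int q * 2 ^ n + real r"
    by (metis of_int_add of_int_mult of_int_of_nat_eq of_int_numeral of_int_power)
  then have "2 * \<delta> * pi + 2 * pi * of_int k / 2 ^ n
      = 2 * \<delta> * pi + 2 * pi * real r / 2 ^ n + 2 * pi * of_int q"
    "2 * \<delta> * pi + 2 * pi * (of_int k + 1) / 2 ^ n
      = 2 * \<delta> * pi + 2 * pi * (real r + 1) / 2 ^ n + 2 * pi * of_int q"
    by (simp_all add: field_simps)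
  then have "wrap {2 * \<delta> * pi + 2 * pi * of_int k / 2 ^ n <.. 2 * \<delta> * pi + 2 * pi * (of_int k + 1) / 2 ^ n}
      = shifted_dyadic_interval \<delta> n r"
    unfolding shifted_dyadic_interval_def by (simp only: wrap_translate_Ioc)
  then show ?thesis using r unfolding shifted_dyadic_arcs_def by blast
qed

section \<open>Covering an arc by a dyadic arc of comparable length\<close>

text \<open>An interval without grid points stays between two consecutive ones, namely those around any
  of its points.\<close>

lemma interval_avoiding_grid:
  assumes J: "is_interval J" "J \<noteq> {}"
    and avoid: "\<And>k::int. 2 * \<delta> * pi + 2 * pi * of_int k / 2 ^ n \<notin> J"
  shows "\<exists>D \<in> shifted_dyadic_arcs \<delta>. wrap J \<subseteq> D \<and> measure lebesgue D = 2 * pi / 2 ^ n"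
proof -
  define g where "g k = 2 * \<delta> * pi + 2 * pi * of_int k / 2 ^ n" for k :: int
  obtain x where x: "x \<in> J" using J by blast
  define k where "k = \<lfloor>(x - 2 * \<delta> * pi) * 2 ^ n / (2 * pi)\<rfloor>"
  have "of_int k \<le> (x - 2 * \<delta> * pi) * 2 ^ n / (2 * pi)"
    "(x - 2 * \<delta> * pi) * 2 ^ n / (2 * pi) < of_int k + 1"
    unfolding k_def by linarith+
  then have gx: "g k \<le> x" "x < g (k + 1)"
    unfolding g_def by (simp_all add: field_simps)
  have "J \<subseteq> {g k<..g (k + 1)}"
  proof
    fix y assume y: "y \<in> J"
    have conv: "z \<in> J" if "u \<in> J" "v \<in> J" "u \<le> z" "z \<le> v" for u v z
      using J(1) that unfolding is_interval_1 by blast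
    have "g k < y"
      using conv[OF y x, of "g k"] gx avoid[of k] by (force simp: g_def)
    moreover have "y < g (k + 1)"
      using conv[OF x y, of "g (k + 1)"] gx avoid[of "k + 1"] unfolding g_def by linarith
    ultimately show "y \<in> {g k<..g (k + 1)}" by simp
  qed
  then have "wrap J \<subseteq> wrap {g k<..g (k + 1)}" by (rule wrap_mono)
  moreover have "wrap {g k<..g (k + 1)} \<in> shifted_dyadic_arcs \<delta>"
    using integer_cell_is_shifted_dyadic_arc[of \<delta> k n] unfolding g_def by simp
  moreover have "measure lebesgue (wrap {g k<..g (k + 1)}) = 2 * pi / 2 ^ n"
  proof -
    have "g (k + 1) = g k + 2 * pi / 2 ^ n" unfolding g_def by (simp add: field_simps)
    moreover have "2 * pi / 2 ^ n \<le> 2 * pi" by (simp add: field_simps)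
    ultimately show ?thesis by (simp add: measure_wrap_Ioc)
  qed
  ultimately show ?thesis by blast
qed

lemma dyadic_separation_le:
  "dyadic_separation \<delta> \<le> 2 ^ n * \<bar>\<delta> - of_int k / 2 ^ n\<bar>"
  unfolding dyadic_separation_def
  by (rule cInf_lower) (auto intro!: bdd_belowI[of _ 0])

lemma dyadic_separation_le_1:
  assumes "0 < \<delta>" "\<delta> < 1"
  shows "dyadic_separation \<delta> \<le> 1"
  using dyadic_separation_le[of \<delta> 0 0] assms by simp

text \<open>The cap at \<open>2\<pi>\<close> is needed because a long interval overlaps itself on the circle.\<close>

lemma measure_wrap_ge:
  assumes "is_interval J" "p \<in> J" "q \<in> J" "0 \<le> L" "L \<le> 2 * pi" "L \<le> \<bar>p - q\<bar>"
  shows "L \<le> measure lebesgue (wrap J)"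
proof -
  have "{min p q<..min p q + L} \<subseteq> J"
  proof
    fix z assume "z \<in> {min p q<..min p q + L}"
    then have "min p q \<le> z" "z \<le> max p q" using assms(6) by (auto simp: min_def max_def split: if_splits)
    moreover have "min p q \<in> J" "max p q \<in> J" using assms by (auto simp: min_def max_def)
    ultimately show "z \<in> J" using assms(1) unfolding is_interval_1 by blast
  qed
  then have "measure lebesgue (wrap {min p q<..min p q + L}) \<le> measure lebesgue (wrap J)"
    using assms by (intro measure_mono_fmeasurable wrap_mono fmeasurable_arc wrap_measurable) auto
  then show ?thesis using assms by (simp add: measure_wrap_Ioc)
qed

text \<open>The place where \<open>dyadic_separation \<delta>\<close> enters. Grid points \<open>2\<pi>j/2^n\<close> and
  \<open>2\<pi>\<delta> + 2\<pi>k/2^n\<close> differ by \<open>2\<pi>\<close> times the distance from \<open>\<delta>\<close> to \<open>(j - k)/2^n\<close>, so an interval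
  that contains both is long. The first grid is written with \<open>\<delta> = 0\<close> to match the shifted form.\<close>

lemma short_interval_misses_a_grid:
  assumes J: "is_interval J" and d1: "dyadic_separation \<delta> \<le> 1" and d0: "0 < dyadic_separation \<delta>"
    and short: "measure lebesgue (wrap J) < 2 * pi * dyadic_separation \<delta> / 2 ^ n"
  shows "(\<forall>k::int. 2 * 0 * pi + 2 * pi * of_int k / 2 ^ n \<notin> J) \<or>
         (\<forall>k::int. 2 * \<delta> * pi + 2 * pi * of_int k / 2 ^ n \<notin> J)"
proof (rule ccontr)
  assume "\<not> ?thesis"
  then obtain j k :: int where p: "2 * pi * of_int j / 2 ^ n \<in> J" 
    and q: "2 * \<delta> * pi + 2 * pi * of_int k / 2 ^ n \<in> J" by auto
  let ?d = "dyadic_separation \<delta>"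
  have "2 * pi * of_int j / 2 ^ n - (2 * \<delta> * pi + 2 * pi * of_int k / 2 ^ n)
      = - (2 * pi * (\<delta> - of_int (j - k) / 2 ^ n))"
    by (simp add: field_simps)
  then have dist: "\<bar>2 * pi * of_int j / 2 ^ n - (2 * \<delta> * pi + 2 * pi * of_int k / 2 ^ n)\<bar>
      = 2 * pi * \<bar>\<delta> - of_int (j - k) / 2 ^ n\<bar>"
    by (simp only: abs_minus_cancel abs_mult) simp
  have "?d / 2 ^ n \<le> \<bar>\<delta> - of_int (j - k) / 2 ^ n\<bar>"
    using dyadic_separation_le[of \<delta> n "j - k"] by (simp add: divide_le_eq mult.commute)
  then have far: "2 * pi * (?d / 2 ^ n) \<le> 2 * pi * \<bar>\<delta> - of_int (j - k) / 2 ^ n\<bar>"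
    by (intro mult_left_mono) auto
  have "?d / 2 ^ n \<le> 1" using d1 by (simp add: divide_le_eq) (meson one_le_power one_le_numeral order_trans)
  then have "2 * pi * (?d / 2 ^ n) \<le> 2 * pi" by (simp only: mult_le_cancel_left2) simp
  then have "2 * pi * (?d / 2 ^ n) \<le> measure lebesgue (wrap J)"
    using d0 far dist by (intro measure_wrap_ge[OF J p q]) (auto simp del: of_int_diff)
  then show False using short by simp
qed

text \<open>The one-third trick, at the scale where \<open>I\<close> is just too short to meet both grids.\<close>

lemma dyadic_cover:
  assumes "0 < \<delta>" "\<delta> < 1" and d0: "0 < dyadic_separation \<delta>" and I: "I \<in> circle_arcs"
  shows "\<exists>D \<in> dyadic_arcs \<union> shifted_dyadic_arcs \<delta>.
    I \<subseteq> D \<and> measure lebesgue D \<le> 2 / dyadic_separation \<delta> * measure lebesgue I"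
proof -
  let ?d = "dyadic_separation \<delta>"
  note d1 = dyadic_separation_le_1[OF assms(1,2)]
  obtain J where J: "is_interval J" "I = wrap J" and pos: "0 < measure lebesgue I"
    using I unfolding circle_arcs_def by blast
  define x where "x = measure lebesgue I / (2 * pi * ?d)"
  have "0 < x" unfolding x_def using pos d0 by simp
  then obtain n0 where "(1 / 2) ^ n0 < x" using real_arch_pow_inv[of x "1/2"] by auto
  then have "(1 / 2) ^ Suc n0 \<le> x" using \<open>0 < x\<close> by simp
  then have ex: "\<exists>n. (1 / 2) ^ Suc n \<le> x" by blast
  \<comment> \<open>The least such \<open>n\<close> is the scale at which both bounds on \<open>|I|\<close> hold, the upper one when
    \<open>n > 0\<close>; for \<open>n = 0\<close> no upper bound is available and the whole circle serves as \<open>D\<close>.\<close>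
  define n where "n = (LEAST n. (1 / 2) ^ Suc n \<le> x)"
  have ge: "(1 / 2) ^ Suc n \<le> x" unfolding n_def by (rule LeastI_ex[OF ex])
  then have len: "2 * pi / 2 ^ n \<le> 2 / ?d * measure lebesgue I"
    unfolding x_def using d0 by (simp add: field_simps power_divide)
  show ?thesis
  proof (cases n)
    case 0
    have "circle = dyadic_interval 0 0" unfolding circle_def dyadic_interval_def by simp
    then have "circle \<in> dyadic_arcs" unfolding dyadic_arcs_def by (auto intro!: exI[of _ 0])
    moreover have "I \<subseteq> circle" using J wrap_subset_circle by simp
    moreover have "measure lebesgue circle = 2 * pi" unfolding circle_def by simp
    ultimately show ?thesis using len 0 by (intro bexI[of _ circle]) auto
  next
    case (Suc l)
    then have "\<not> (1 / 2) ^ Suc l \<le> x"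
      unfolding n_def by (intro not_less_Least) simp
    then have "x < 1 / 2 ^ n" using Suc by (simp add: power_divide)
    then have "measure lebesgue (wrap J) < 2 * pi * ?d / 2 ^ n"
      unfolding x_def J(2) using d0 by (simp add: field_simps)
    from short_interval_misses_a_grid[OF J(1) d1 d0 this]
    have "\<exists>\<epsilon>\<in>{0, \<delta>}. \<forall>k::int. 2 * \<epsilon> * pi + 2 * pi * of_int k / 2 ^ n \<notin> J" by auto
    moreover have "J \<noteq> {}" using pos J by (auto simp: wrap_def)
    ultimately obtain \<epsilon> D where "\<epsilon> \<in> {0, \<delta>}" "D \<in> shifted_dyadic_arcs \<epsilon>" "wrap J \<subseteq> D"
      "measure lebesgue D = 2 * pi / 2 ^ n"
      using interval_avoiding_grid[OF J(1)] by blast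
    then show ?thesis using len J by (intro bexI[of _ D]) (auto simp: dyadic_arcs_eq_shifted)
  qed
qed

section \<open>Comparison of mean oscillations\<close>

text \<open>With \<open>c\<close> the average over \<open>D\<close>, the average over \<open>I\<close> differs from \<open>c\<close> by at most the mean
  of \<open>|\<phi> - c|\<close> over \<open>I\<close>. Replacing the average over \<open>I\<close> by \<open>c\<close> therefore costs a factor \<open>2\<close>,
  and extending the integral of \<open>|\<phi> - c|\<close> from \<open>I\<close> to \<open>D\<close> only increases it; the remaining factor
  is the change of normalisation.\<close>

lemma mean_oscillation_subset:
  assumes D: "D \<in> fmeasurable lebesgue" and I: "I \<in> sets lebesgue" "I \<subseteq> D"
    and pos: "0 < measure lebesgue I" and int: "set_integrable lebesgue D \<phi>"
  shows "mean_oscillation \<phi> I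
    \<le> 2 * (measure lebesgue D / measure lebesgue I) * mean_oscillation \<phi> D"
proof -
  define c where "c = average \<phi> D"
  define a where "a = average \<phi> I"
  define \<mu> where "\<mu> = measure lebesgue I"
  have If: "I \<in> fmeasurable lebesgue" using D I by (meson fmeasurableI2)
  then have If': "I \<in> sets lebesgue" "emeasure lebesgue I \<noteq> \<infinity>"
    by (auto simp: fmeasurable_def)
  have intI: "set_integrable lebesgue I \<phi>" using set_integrable_subset[OF int I] .
  have const: "set_integrable lebesgue A (\<lambda>_. z)" if "A \<in> fmeasurable lebesgue" for A and z :: complex
    using that absolutely_integrable_on_const by simp
  have normI: "set_integrable lebesgue I (\<lambda>\<theta>. norm (\<phi> \<theta> - z))" for z
    using intI const[OF If] by (intro set_integrable_norm set_integral_diff(1))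
  have normD: "set_integrable lebesgue D (\<lambda>\<theta>. norm (\<phi> \<theta> - c))"
    using int const[OF D] by (intro set_integrable_norm set_integral_diff(1))
  have mono: "(LINT \<theta>:I|lebesgue. norm (\<phi> \<theta> - c)) \<le> (LINT \<theta>:D|lebesgue. norm (\<phi> \<theta> - c))"
    using normI[of c] normD I unfolding set_integrable_def set_lebesgue_integral_def
    by (intro integral_mono) (auto split: split_indicator)
  have "(LINT \<theta>:I|lebesgue. \<phi> \<theta> - c) = (LINT \<theta>:I|lebesgue. \<phi> \<theta>) - (LINT \<theta>:I|lebesgue. c)"
    using intI const[OF If] by (rule set_integral_diff(2))
  also have "\<dots> = \<mu> *\<^sub>R (a - c)"
    using pos set_integral_const[OF If', of c]
    unfolding a_def average_def \<mu>_def by (simp add: scaleR_diff_right)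
  finally have "\<mu> * norm (a - c) = norm (LINT \<theta>:I|lebesgue. \<phi> \<theta> - c)"
    using pos unfolding \<mu>_def by simp
  also have "\<dots> \<le> (LINT \<theta>:I|lebesgue. norm (\<phi> \<theta> - c))"
    using intI const[OF If] by (intro set_integral_norm_bound set_integral_diff(1))
  finally have ac: "\<mu> * norm (a - c) \<le> (LINT \<theta>:I|lebesgue. norm (\<phi> \<theta> - c))" .
  have "(LINT \<theta>:I|lebesgue. norm (\<phi> \<theta> - a))
      \<le> (LINT \<theta>:I|lebesgue. norm (\<phi> \<theta> - c) + norm (a - c))"
  proof (rule set_integral_mono)
    show "set_integrable lebesgue I (\<lambda>\<theta>. norm (\<phi> \<theta> - c) + norm (a - c))"
      using normI If by (intro set_integral_add(1)) (auto simp: absolutely_integrable_on_const)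
    show "norm (\<phi> \<theta> - a) \<le> norm (\<phi> \<theta> - c) + norm (a - c)" for \<theta>
      using norm_triangle_ineq4[of "\<phi> \<theta> - c" "a - c"] by simp
  qed (rule normI)
  also have "\<dots> = (LINT \<theta>:I|lebesgue. norm (\<phi> \<theta> - c)) + (LINT \<theta>:I|lebesgue. norm (a - c))"
    using normI If by (intro set_integral_add(2)) (auto simp: absolutely_integrable_on_const)
  also have "(LINT \<theta>:I|lebesgue. norm (a - c)) = \<mu> * norm (a - c)"
    using set_integral_const[OF If', of "norm (a - c)"] unfolding \<mu>_def by simp
  finally have main: "(LINT \<theta>:I|lebesgue. norm (\<phi> \<theta> - a)) \<le> 2 * (LINT \<theta>:D|lebesgue. norm (\<phi> \<theta> - c))"
    using ac mono by linarith
  have "\<mu> \<le> measure lebesgue D" unfolding \<mu>_def using I D by (intro measure_mono_fmeasurable) auto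
  then have "0 < measure lebesgue D" using pos unfolding \<mu>_def by linarith
  then have "2 * (measure lebesgue D / \<mu>) * mean_oscillation \<phi> D
      = 2 * (LINT \<theta>:D|lebesgue. norm (\<phi> \<theta> - c)) / \<mu>"
    unfolding mean_oscillation_def c_def by simp
  moreover have "mean_oscillation \<phi> I = (LINT \<theta>:I|lebesgue. norm (\<phi> \<theta> - a)) / \<mu>"
    unfolding mean_oscillation_def a_def \<mu>_def ..
  ultimately show ?thesis
    using main pos unfolding \<mu>_def by (simp add: divide_right_mono)
qed

lemma mean_oscillation_nonneg: "0 \<le> mean_oscillation \<phi> I"
  unfolding mean_oscillation_def set_lebesgue_integral_def by simp

lemma mean_oscillation_arc_le_dyadic:
  assumes "0 < \<delta>" "\<delta> < 1" and d0: "0 < dyadic_separation \<delta>"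
    and \<phi>: "\<phi> \<in> L1_circle" and I: "I \<in> circle_arcs"
  shows "\<exists>D \<in> dyadic_arcs \<union> shifted_dyadic_arcs \<delta>.
    mean_oscillation \<phi> I \<le> 4 / dyadic_separation \<delta> * mean_oscillation \<phi> D"
proof -
  let ?d = "dyadic_separation \<delta>"
  obtain D where D: "D \<in> dyadic_arcs \<union> shifted_dyadic_arcs \<delta>" "I \<subseteq> D"
    and len: "measure lebesgue D \<le> 2 / ?d * measure lebesgue I"
    using dyadic_cover[OF assms(1,2) d0 I] by blast
  have arc: "A \<in> fmeasurable lebesgue \<and> A \<subseteq> circle \<and> 0 < measure lebesgue A" if "A \<in> circle_arcs" for A
    using that fmeasurable_arc wrap_subset_circle unfolding circle_arcs_def by blast
  have "D \<in> circle_arcs" using D(1) shifted_dyadic_arcs_subset dyadic_arcs_eq_shifted by blast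
  then have "D \<in> fmeasurable lebesgue" "D \<subseteq> circle" using arc by auto
  moreover have I': "I \<in> sets lebesgue" "0 < measure lebesgue I" using arc[OF I] by auto
  moreover have "set_integrable lebesgue D \<phi>"
    using \<phi> \<open>D \<subseteq> circle\<close> \<open>D \<in> fmeasurable lebesgue\<close> unfolding L1_circle_def by (auto intro: set_integrable_subset)
  ultimately have "mean_oscillation \<phi> I
      \<le> 2 * (measure lebesgue D / measure lebesgue I) * mean_oscillation \<phi> D"
    using D by (intro mean_oscillation_subset)
  also have "\<dots> \<le> 2 * (2 / ?d) * mean_oscillation \<phi> D"
    using len I'(2) by (intro mult_right_mono mult_left_mono mean_oscillation_nonneg) (auto simp: divide_le_eq)
  finally show ?thesis using D(1) by (intro bexI[of _ D]) auto
qed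

text \<open>For integrable \<open>\<phi>\<close> whose norms may be infinite, so that the same bound yields the inclusion
  of the intersection in \<open>BMO circle_arcs\<close> as well as the inequality of norms.\<close>

lemma bmo_norm_circle_le_dyadic:
  assumes "0 < \<delta>" "\<delta> < 1" and d0: "0 < dyadic_separation \<delta>" and \<phi>: "\<phi> \<in> L1_circle"
  shows "bmo_norm circle_arcs \<phi> \<le> ereal (4 / dyadic_separation \<delta>)
    * max (bmo_norm dyadic_arcs \<phi>) (bmo_norm (shifted_dyadic_arcs \<delta>) \<phi>)"
proof -
  let ?d = "dyadic_separation \<delta>"
  let ?M = "max (bmo_norm dyadic_arcs \<phi>) (bmo_norm (shifted_dyadic_arcs \<delta>) \<phi>)"
  have "ereal (mean_oscillation \<phi> I) \<le> ereal (4 / ?d) * ?M" if I: "I \<in> circle_arcs" for I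
  proof -
    obtain D where D: "D \<in> dyadic_arcs \<union> shifted_dyadic_arcs \<delta>"
      and le: "mean_oscillation \<phi> I \<le> 4 / ?d * mean_oscillation \<phi> D"
      using mean_oscillation_arc_le_dyadic[OF assms I] by blast
    have "ereal (mean_oscillation \<phi> D) \<le> ?M"
      using D unfolding bmo_norm_def by (auto simp: le_max_iff_disj intro: SUP_upper)
    then have "ereal (4 / ?d) * ereal (mean_oscillation \<phi> D) \<le> ereal (4 / ?d) * ?M"
      using d0 by (intro ereal_mult_left_mono) auto
    moreover have "ereal (mean_oscillation \<phi> I) \<le> ereal (4 / ?d) * ereal (mean_oscillation \<phi> D)"
      using le by simp
    ultimately show ?thesis by (rule order_trans[rotated])
  qed
  then show ?thesis unfolding bmo_norm_def[of circle_arcs] by (rule SUP_least)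
qed

theorem corollary2p3:
  fixes \<delta> :: real
  assumes "0 < \<delta>" and "\<delta> < 1" and "dyadic_separation \<delta> > 0"
  shows "BMO circle_arcs = BMO dyadic_arcs \<inter> BMO (shifted_dyadic_arcs \<delta>) \<and>
    (\<exists>c C :: real. c > 0 \<and> C > 0 \<and>
      (\<forall>\<phi> \<in> BMO circle_arcs.
         ereal c * bmo_norm circle_arcs \<phi>
           \<le> max (bmo_norm dyadic_arcs \<phi>) (bmo_norm (shifted_dyadic_arcs \<delta>) \<phi>) \<and>
         max (bmo_norm dyadic_arcs \<phi>) (bmo_norm (shifted_dyadic_arcs \<delta>) \<phi>)
           \<le> ereal C * bmo_norm circle_arcs \<phi>))"
proof -
  let ?d = "dyadic_separation \<delta>"
  let ?M = "\<lambda>\<phi>. max (bmo_norm dyadic_arcs \<phi>) (bmo_norm (shifted_dyadic_arcs \<delta>) \<phi>)"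
  have upper: "?M \<phi> \<le> bmo_norm circle_arcs \<phi>" for \<phi>
    using shifted_dyadic_arcs_subset[of 0] shifted_dyadic_arcs_subset[of \<delta>]
    unfolding bmo_norm_def dyadic_arcs_eq_shifted by (intro max.boundedI SUP_subset_mono) auto
  note lower = bmo_norm_circle_le_dyadic[OF assms]
  have "\<phi> \<in> BMO circle_arcs \<longleftrightarrow> \<phi> \<in> BMO dyadic_arcs \<inter> BMO (shifted_dyadic_arcs \<delta>)" for \<phi>
  proof
    assume "\<phi> \<in> BMO circle_arcs"
    then show "\<phi> \<in> BMO dyadic_arcs \<inter> BMO (shifted_dyadic_arcs \<delta>)"
      using upper[of \<phi>] unfolding BMO_def by auto
  next
    assume "\<phi> \<in> BMO dyadic_arcs \<inter> BMO (shifted_dyadic_arcs \<delta>)"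
    then have "\<phi> \<in> L1_circle" "?M \<phi> < \<infinity>" unfolding BMO_def by (auto simp: max_def)
    moreover from \<open>?M \<phi> < \<infinity>\<close> have "ereal (4 / ?d) * ?M \<phi> < \<infinity>"
      using assms(3) by (cases "?M \<phi>") auto
    ultimately show "\<phi> \<in> BMO circle_arcs"
      using lower[of \<phi>] unfolding BMO_def by auto
  qed
  moreover have "ereal (?d / 4) * bmo_norm circle_arcs \<phi> \<le> ?M \<phi>" if "\<phi> \<in> BMO circle_arcs" for \<phi>
  proof -
    have "\<phi> \<in> L1_circle" using that unfolding BMO_def by simp
    then have "ereal (?d / 4) * bmo_norm circle_arcs \<phi> \<le> ereal (?d / 4) * (ereal (4 / ?d) * ?M \<phi>)"
      using lower assms(3) by (intro ereal_mult_left_mono) auto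
    also have "\<dots> = ?M \<phi>"
      using assms(3) by (simp add: mult.assoc[symmetric] one_ereal_def[symmetric])
    finally show ?thesis .
  qed
  ultimately show ?thesis
    using assms(3) upper by (intro conjI exI[of _ "?d / 4"] exI[of _ 1]) auto
qed

end
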